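(* Let $\mathcal{M}\subset\mathcal{K}_c(\mathbb{R}^d)$ be nonempty and compact, and let $(\mathcal{M}_k)_{k=0}^\infty$ be a sequence of nonempty and compact subsets $\mathcal{M}_k\subset\mathcal{K}_c(\mathbb{R}^d)$ with $$\lim_{k\to\infty}\mathcal{D}_H(\mathcal{M},\mathcal{M}_k)=0.$$ Let $\Phi:\mathcal{K}_c(\mathbb{R}^d)\to\mathbb{R}$ be continuous, let $(\Phi_k)_{k=0}^\infty$ be a sequence of mappings $\Phi_k:\mathcal{M}_k\to\mathbb{R}$ satisfying $$\lim_{k\to\infty}\sup_{C\in\mathcal{M}_k}|\Phi(C)-\Phi_k(C)|=0,$$ and let $\mathrm{argmin}_{C\in\mathcal{M}_k}\Phi_k(C)\neq\emptyset$ for all $k$. Then $\mathrm{argmin}_{C\in\mathcal{M}}\Phi(C)\neq\emptyset$, and $$\lim_{k\to\infty}\mathcal{D}\big(\mathrm{argmin}_{C\in\mathcal{M}_k}\Phi_k(C),\ \mathrm{argmin}_{C\in\mathcal{M}}\Phi(C)\big)=0.$$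
   Context: $\mathcal{K}_c(\mathbb{R}^d)$ is the space of all nonempty convex compact subsets of $\mathbb{R}^d$, equipped with the Hausdorff distance $\mathrm{dist}_H(C,\tilde C):=\max\{\mathrm{dist}(C,\tilde C),\mathrm{dist}(\tilde C,C)\}$, where $\mathrm{dist}(C,\tilde C):=\sup_{c\in C}\inf_{\tilde c\in\tilde C}\|c-\tilde c\|_2$. Convergence, continuity and compactness are understood with respect to $\mathrm{dist}_H$. For sets $\mathcal{M},\tilde{\mathcal{M}}\subset\mathcal{K}_c(\mathbb{R}^d)$ put $$\mathcal{D}(\mathcal{M},\tilde{\mathcal{M}}):=\sup_{C\in\mathcal{M}}\inf_{\tilde C\in\tilde{\mathcal{M}}}\mathrm{dist}_H(C,\tilde C),\qquad \mathcal{D}_H(\mathcal{M},\tilde{\mathcal{M}}):=\max\{\mathcal{D}(\mathcal{M},\tilde{\mathcal{M}}),\mathcal{D}(\tilde{\mathcal{M}},\mathcal{M})\}.$$ $\mathrm{argmin}_{C\in\mathcal{M}}\Phi(C)$ denotes the set of global minimizers of $\Phi$ over $\mathcal{M}$. *)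

theory Defs
  imports "HOL-Analysis.Analysis"
begin

text \<open>The one-sided distance of two sets. Real-valued suprema and infima are only meaningful when
  taken over nonempty bounded sets, which is the case for nonempty compact arguments.\<close>

definition excess :: "'a::euclidean_space set \<Rightarrow> 'a set \<Rightarrow> real"
  where "excess C D = (SUP c\<in>C. INF d\<in>D. norm (c - d))"

definition hausdorff_dist :: "'a::euclidean_space set \<Rightarrow> 'a set \<Rightarrow> real"
  where "hausdorff_dist C D = max (excess C D) (excess D C)"

lemma excess_upper:
  assumes "C \<noteq> {}" "compact C" "D \<noteq> {}" "compact D" and c: "c \<in> C"
  shows "infdist c D \<le> excess C D"
proof -
  have D: "D \<noteq> {}" and C: "compact C"
    using assms by auto
  have eq: "excess C D = (SUP c\<in>C. infdist c D)"
    using D by (simp add: excess_def infdist_def dist_norm)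
  have "compact ((\<lambda>c. infdist c D) ` C)"
    by (intro compact_continuous_image continuous_intros C)
  then have "bdd_above ((\<lambda>c. infdist c D) ` C)"
    by (simp add: bounded_imp_bdd_above compact_imp_bounded)
  then show ?thesis
    unfolding eq by (rule cSUP_upper[OF c])
qed

lemma excess_least:
  assumes "C \<noteq> {}" "compact C" "D \<noteq> {}" "compact D" and le: "\<And>c. c \<in> C \<Longrightarrow> infdist c D \<le> r"
  shows "excess C D \<le> r"
proof -
  have D: "D \<noteq> {}" and C: "C \<noteq> {}"
    using assms by auto
  have eq: "excess C D = (SUP c\<in>C. infdist c D)"
    using D by (simp add: excess_def infdist_def dist_norm)
  show ?thesis
    unfolding eq using C le by (rule cSUP_least)
qed

lemma excess_nonneg:
  assumes "C \<noteq> {}" "compact C" "D \<noteq> {}" "compact D"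
  shows "0 \<le> excess C D"
proof -
  obtain c where "c \<in> C" using assms by auto
  then show ?thesis
    using excess_upper[OF assms] infdist_nonneg[of c D] by (meson order_trans)
qed

lemma excess_triangle:
  assumes "C \<noteq> {}" "compact C" "D \<noteq> {}" "compact D" "E \<noteq> {}" "compact E"
  shows "excess C E \<le> excess C D + excess D E"
proof (rule excess_least[OF assms(1,2,5,6)])
  fix c assume c: "c \<in> C"
  have "closed D" "D \<noteq> {}"
    using assms by (auto simp: compact_imp_closed)
  then obtain d where d: "d \<in> D" "infdist c D = dist c d"
    using infdist_attains_inf by metis
  have "infdist c E \<le> infdist d E + dist c d"
    by (rule infdist_triangle)
  also have "\<dots> \<le> excess D E + excess C D"
    using excess_upper[OF assms(3-6) d(1)] excess_upper[OF assms(1-4) c] d(2) by linarith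
  finally show "infdist c E \<le> excess C D + excess D E" by simp
qed

lemma excess_le_0_iff:
  assumes "C \<noteq> {}" "compact C" "D \<noteq> {}" "compact D"
  shows "excess C D \<le> 0 \<longleftrightarrow> C \<subseteq> D"
proof
  have D: "closed D" "D \<noteq> {}"
    using assms by (auto simp: compact_imp_closed)
  assume le: "excess C D \<le> 0"
  show "C \<subseteq> D"
  proof
    fix c assume "c \<in> C"
    then have "infdist c D = 0"
      using excess_upper[OF assms] le infdist_nonneg[of c D] by (meson order_antisym order_trans)
    then show "c \<in> D"
      using D in_closed_iff_infdist_zero by blast
  qed
next
  assume "C \<subseteq> D"
  then show "excess C D \<le> 0"
    by (intro excess_least[OF assms]) auto
qed

text \<open>Unlike in some of the literature, a convex body here may have empty interior.\<close>

typedef (overloaded) 'a convex_body =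
    "{C :: 'a::euclidean_space set. C \<noteq> {} \<and> convex C \<and> compact C}"
  morphisms body_set Convex_Body
  by (rule exI[of _ "{0}"]) auto

lemma body_set_nonempty: "body_set A \<noteq> {}"
  and convex_body_set: "convex (body_set A)"
  and compact_body_set: "compact (body_set A)"
  using body_set[of A] by auto

instantiation convex_body :: (euclidean_space) metric_space
begin

definition dist_convex_body :: "'a convex_body \<Rightarrow> 'a convex_body \<Rightarrow> real"
  where "dist A B = hausdorff_dist (body_set A) (body_set B)"

definition uniformity_convex_body :: "('a convex_body \<times> 'a convex_body) filter"
  where "uniformity_convex_body = (INF e\<in>{0<..}. principal {(A, B). dist A B < e})"

definition open_convex_body :: "'a convex_body set \<Rightarrow> bool"
  where "open_convex_body U \<longleftrightarrow>
    (\<forall>A\<in>U. eventually (\<lambda>(A', B). A' = A \<longrightarrow> B \<in> U) uniformity)"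

instance
proof
  fix A B E :: "'a convex_body"
  note [simp] = body_set_nonempty compact_body_set
  show "dist A B = 0 \<longleftrightarrow> A = B"
  proof -
    have "dist A B = 0 \<longleftrightarrow> excess (body_set A) (body_set B) \<le> 0 \<and> excess (body_set B) (body_set A) \<le> 0"
      using excess_nonneg[of "body_set A" "body_set B"]
      by (auto simp: dist_convex_body_def hausdorff_dist_def)
    also have "\<dots> \<longleftrightarrow> body_set A = body_set B"
      by (auto simp: excess_le_0_iff)
    finally show ?thesis by (simp add: body_set_inject)
  qed
  show "dist A B \<le> dist A E + dist B E"
    using excess_triangle[of "body_set A" "body_set E" "body_set B"]
      excess_triangle[of "body_set B" "body_set E" "body_set A"]
    by (auto simp: dist_convex_body_def hausdorff_dist_def)
qed (simp_all add: uniformity_convex_body_def open_convex_body_def)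

end

text \<open>Extended reals, because sets of convex bodies need not be bounded.\<close>

definition family_excess ::
    "'a::euclidean_space convex_body set \<Rightarrow> 'a convex_body set \<Rightarrow> ereal"
  where "family_excess M N = (SUP A\<in>M. INF B\<in>N. ereal (dist A B))"

definition family_hausdorff_dist ::
    "'a::euclidean_space convex_body set \<Rightarrow> 'a convex_body set \<Rightarrow> ereal"
  where "family_hausdorff_dist M N = max (family_excess M N) (family_excess N M)"

definition argmin_set :: "('b \<Rightarrow> real) \<Rightarrow> 'b set \<Rightarrow> 'b set"
  where "argmin_set f M = {x. is_arg_min f (\<lambda>y. y \<in> M) x}"

end

theory Submission
  imports Defs
begin

text \<open>
  The argument is the standard compactness proof that minimizers are stable under perturbation, and
  uses nothing about convex bodies beyond the fact that they form a metric space. A minimizer of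
  \<open>\<Phi>\<close> exists because \<open>\<Phi>\<close> is continuous on the compact family \<open>M\<close>.

  For the convergence, let \<open>c k\<close> minimize \<open>\<Phi>k k\<close> over \<open>Mk k\<close>. The point of \<open>M\<close> nearest to \<open>c k\<close> has
  a vanishing distance to \<open>c k\<close>, so compactness of \<open>M\<close> makes some subsequence of \<open>c\<close> converge to a
  point \<open>a\<close> of \<open>M\<close>. This \<open>a\<close> minimizes \<open>\<Phi>\<close>: every competitor \<open>b\<close> in \<open>M\<close> is the limit of its nearest
  points \<open>b' k\<close> in \<open>Mk k\<close>, and passing to the limit in \<open>\<Phi>k k (c k) \<le> \<Phi>k k (b' k)\<close> yields
  \<open>\<Phi> a \<le> \<Phi> b\<close> (lemma \<open>limit_of_minimizers_is_minimizer\<close>). Hence \<open>c\<close> has to approach the minimizers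
  of \<open>\<Phi>\<close> (lemma \<open>infdist_minimizers_tendsto_0\<close>). As this holds for every selection of minimizers
  \<open>c k\<close>, in particular for one that is as bad as possible at each \<open>k\<close>, the convergence is
  uniform over the minimizers, which is the claim.
\<close>

lemma argmin_set_iff:
  "x \<in> argmin_set f A \<longleftrightarrow> x \<in> A \<and> (\<forall>y\<in>A. f x \<le> f y)"
  by (auto simp: argmin_set_def is_arg_min_linorder)

lemma argmin_set_nonempty:
  assumes "compact A" "A \<noteq> {}" "continuous_on A f"
  shows "argmin_set f A \<noteq> {}"
proof -
  obtain x where "x \<in> A" "\<forall>y\<in>A. f x \<le> f y"
    using continuous_attains_inf[OF assms] by blast
  then have "x \<in> argmin_set f A"
    by (simp add: argmin_set_iff)
  then show ?thesis by blast
qed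

lemma compact_attains_infdist:
  fixes x :: "'b::metric_space"
  assumes "compact A" "A \<noteq> {}"
  obtains y where "y \<in> A" "infdist x A = dist x y"
proof -
  have "continuous_on A (dist x)"
    by (intro continuous_intros)
  then obtain y where y: "y \<in> A" "\<And>z. z \<in> A \<Longrightarrow> dist x y \<le> dist x z"
    using continuous_attains_inf[OF assms] by blast
  have "infdist x A = dist x y"
    using assms y by (intro antisym infdist_le) (auto simp: infdist_def intro: cINF_greatest)
  with y(1) show ?thesis by (rule that)
qed

lemma tendsto_of_dist_tendsto_0:
  fixes x y :: "nat \<Rightarrow> 'b::metric_space"
  assumes "y \<longlonglongrightarrow> l" and "(\<lambda>n. dist (x n) (y n)) \<longlonglongrightarrow> 0"
  shows "x \<longlonglongrightarrow> l"
proof -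
  have "(\<lambda>n. dist (x n) (y n) + dist (y n) l) \<longlonglongrightarrow> 0"
    using tendsto_add[OF assms(2) iffD1[OF tendsto_dist_iff assms(1)]] by simp
  then have "(\<lambda>n. dist (x n) l) \<longlonglongrightarrow> 0"
    by (rule tendsto_sandwich[OF _ _ tendsto_const, rotated 2])
      (simp_all add: dist_triangle)
  then show ?thesis by (simp add: tendsto_dist_iff[of x l])
qed

text \<open>The statement is about a subsequence because this is what compactness will provide; the
  competitors and the errors only need to be controlled along the whole sequence.\<close>

lemma limit_of_minimizers_is_minimizer:
  fixes \<Phi> :: "'b::metric_space \<Rightarrow> real"
  assumes cont: "continuous_on UNIV \<Phi>"
    and competitor: "\<And>b. b \<in> M \<Longrightarrow> \<exists>b'. (\<forall>k. b' k \<in> N k) \<and> b' \<longlonglongrightarrow> b"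
    and error: "\<And>x. (\<And>k. x k \<in> N k) \<Longrightarrow> (\<lambda>k. \<Phi> (x k) - f k (x k)) \<longlonglongrightarrow> 0"
    and c: "\<And>k. c k \<in> argmin_set (f k) (N k)"
    and r: "strict_mono r" and lim: "(c \<circ> r) \<longlonglongrightarrow> a" and a: "a \<in> M"
  shows "a \<in> argmin_set \<Phi> M"
  unfolding argmin_set_iff
proof (intro conjI ballI a)
  fix b assume "b \<in> M"
  then obtain b' where b': "\<And>k. b' k \<in> N k" "b' \<longlonglongrightarrow> b"
    using competitor by blast
  have cont_seq: "(\<lambda>i. \<Phi> (x i)) \<longlonglongrightarrow> \<Phi> l" if "x \<longlonglongrightarrow> l" for x :: "nat \<Rightarrow> 'b" and l
    using continuous_on_tendsto_compose[OF cont that] by simp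
  have f_lim: "(\<lambda>i. f (r i) (x (r i))) \<longlonglongrightarrow> \<Phi> l"
    if "\<And>k. x k \<in> N k" and "(x \<circ> r) \<longlonglongrightarrow> l" for x l
  proof -
    have "(\<lambda>i. \<Phi> (x (r i)) - f (r i) (x (r i))) \<longlonglongrightarrow> 0"
      using LIMSEQ_subseq_LIMSEQ[OF error[of x] r] that(1) by (simp add: o_def)
    from tendsto_diff[OF cont_seq[OF that(2)] this] show ?thesis by (simp add: o_def)
  qed
  have "c k \<in> N k" for k
    using c by (simp add: argmin_set_iff)
  then have "(\<lambda>i. f (r i) (c (r i))) \<longlonglongrightarrow> \<Phi> a"
    using lim by (rule f_lim)
  moreover have "(\<lambda>i. f (r i) (b' (r i))) \<longlonglongrightarrow> \<Phi> b"
    using b'(1) LIMSEQ_subseq_LIMSEQ[OF b'(2) r] by (rule f_lim)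
  moreover have "f (r i) (c (r i)) \<le> f (r i) (b' (r i))" for i
    using c[of "r i"] b'(1)[of "r i"] by (simp add: argmin_set_iff)
  ultimately show "\<Phi> a \<le> \<Phi> b"
    by (blast intro: LIMSEQ_le)
qed

text \<open>A selection staying away from the minimizers of \<open>\<Phi>\<close> along a subsequence would, by compactness
  of \<open>M\<close>, accumulate at a point which the previous lemma shows to be such a minimizer.\<close>

lemma infdist_minimizers_tendsto_0:
  fixes \<Phi> :: "'b::metric_space \<Rightarrow> real"
  assumes cont: "continuous_on UNIV \<Phi>" and M: "compact M"
    and competitor: "\<And>b. b \<in> M \<Longrightarrow> \<exists>b'. (\<forall>k. b' k \<in> N k) \<and> b' \<longlonglongrightarrow> b"
    and error: "\<And>x. (\<And>k. x k \<in> N k) \<Longrightarrow> (\<lambda>k. \<Phi> (x k) - f k (x k)) \<longlonglongrightarrow> 0"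
    and c: "\<And>k. c k \<in> argmin_set (f k) (N k)"
    and p: "\<And>k. p k \<in> M" "(\<lambda>k. dist (c k) (p k)) \<longlonglongrightarrow> 0"
  shows "(\<lambda>k. infdist (c k) (argmin_set \<Phi> M)) \<longlonglongrightarrow> 0"
proof (rule order_tendstoI)
  fix e :: real assume "e < 0"
  then show "\<forall>\<^sub>F k in sequentially. e < infdist (c k) (argmin_set \<Phi> M)"
    by (auto intro!: always_eventually less_le_trans[OF _ infdist_nonneg])
next
  fix e :: real assume e: "0 < e"
  show "\<forall>\<^sub>F k in sequentially. infdist (c k) (argmin_set \<Phi> M) < e"
  proof (rule ccontr)
    assume "\<not> ?thesis"
    then obtain r :: "nat \<Rightarrow> nat"
      where r: "strict_mono r" and far: "\<And>i. e \<le> infdist (c (r i)) (argmin_set \<Phi> M)"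
      by (auto dest!: not_eventually_sequentiallyD simp: not_less)
    obtain a s where a: "a \<in> M" and s: "strict_mono (s :: nat \<Rightarrow> nat)"
      and ps: "((p \<circ> r) \<circ> s) \<longlonglongrightarrow> a"
      using seq_compactE[OF compact_imp_seq_compact[OF M], of "p \<circ> r"] p(1) by (metis comp_apply)
    have rs: "strict_mono (r \<circ> s)"
      using r s by (rule strict_mono_o)
    have cl: "(c \<circ> (r \<circ> s)) \<longlonglongrightarrow> a"
      using LIMSEQ_subseq_LIMSEQ[OF p(2) rs]
      by (intro tendsto_of_dist_tendsto_0[OF ps]) (simp add: o_def)
    have "a \<in> argmin_set \<Phi> M"
      using cont competitor error c rs cl a by (rule limit_of_minimizers_is_minimizer)
    then have "e \<le> dist (c (r (s i))) a" for i
      using order_trans[OF far infdist_le] by blast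
    moreover have "\<forall>\<^sub>F i in sequentially. dist (c (r (s i))) a < e"
      using tendstoD[OF cl e] by simp
    ultimately show False
      using eventually_happens'[OF sequentially_bot] by (meson not_le)
  qed
qed

lemma infdist_le_family_excess:
  assumes "A \<in> M"
  shows "ereal (infdist A N) \<le> family_excess M N"
proof -
  have "ereal (infdist A N) \<le> (INF B\<in>N. ereal (dist A B))"
    by (intro INF_greatest) (simp add: infdist_le)
  also have "\<dots> \<le> family_excess M N"
    unfolding family_excess_def using assms by (rule SUP_upper)
  finally show ?thesis .
qed

text \<open>Nonemptiness of \<open>N\<close> matters: the infimum over the empty family is infinite, whereas
  \<open>infdist\<close> to the empty set is \<open>0\<close>.\<close>

lemma family_excess_le:
  assumes "N \<noteq> {}" and "\<And>A. A \<in> M \<Longrightarrow> infdist A N < e"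
  shows "family_excess M N \<le> ereal e"
  unfolding family_excess_def
proof (rule SUP_least)
  fix A assume "A \<in> M"
  with assms obtain B where "B \<in> N" "dist A B < e"
    by (auto simp: infdist_def cINF_less_iff)
  then show "(INF B\<in>N. ereal (dist A B)) \<le> ereal e"
    by (intro INF_lower2[of B]) auto
qed

lemma family_excess_nonneg:
  assumes "M \<noteq> {}"
  shows "0 \<le> family_excess M N"
proof -
  obtain A where "A \<in> M" using assms by blast
  have "0 \<le> ereal (infdist A N)" by (simp add: infdist_nonneg)
  also have "\<dots> \<le> family_excess M N" using \<open>A \<in> M\<close> by (rule infdist_le_family_excess)
  finally show ?thesis .
qed

lemma real_tendsto_0_of_ereal_bound:
  assumes "X \<longlonglongrightarrow> 0" and "\<And>k. 0 \<le> x k" "\<And>k. ereal (x k) \<le> X k"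
  shows "x \<longlonglongrightarrow> 0"
proof -
  have "(\<lambda>k. ereal (x k)) \<longlonglongrightarrow> 0"
    by (rule tendsto_sandwich[OF _ _ tendsto_const assms(1)]) (use assms in auto)
  then show ?thesis by (simp add: zero_ereal_def)
qed

text \<open>Nearest points turn convergence of families into convergence of sequences of bodies.\<close>

lemma nearest_bodies:
  assumes lim: "(\<lambda>k. family_excess (P k) (Q k)) \<longlonglongrightarrow> 0" and A: "\<And>k. A k \<in> P k"
    and Q: "\<And>k. Q k \<noteq> {}" "\<And>k. compact (Q k)"
  obtains B where "\<And>k. B k \<in> Q k" "(\<lambda>k. dist (A k) (B k)) \<longlonglongrightarrow> 0"
proof -
  have "\<exists>B. B \<in> Q k \<and> infdist (A k) (Q k) = dist (A k) B" for k
    using compact_attains_infdist[OF Q(2,1)] by metis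
  then obtain B where B: "\<And>k. B k \<in> Q k" "\<And>k. infdist (A k) (Q k) = dist (A k) (B k)"
    by metis
  have "(\<lambda>k. dist (A k) (B k)) \<longlonglongrightarrow> 0"
    using lim by (rule real_tendsto_0_of_ereal_bound)
      (simp_all add: B(2)[symmetric] infdist_nonneg infdist_le_family_excess A)
  with B(1) show ?thesis by (rule that)
qed

theorem theorem44:
  fixes M :: "(real ^ 'd) convex_body set"
    and Mk :: "nat \<Rightarrow> (real ^ 'd) convex_body set"
    and \<Phi> :: "(real ^ 'd) convex_body \<Rightarrow> real"
    and \<Phi>k :: "nat \<Rightarrow> (real ^ 'd) convex_body \<Rightarrow> real"
  assumes "M \<noteq> {}" and "compact M"
    and "\<And>k. Mk k \<noteq> {}" and "\<And>k. compact (Mk k)"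
    and "(\<lambda>k. family_hausdorff_dist M (Mk k)) \<longlonglongrightarrow> 0"
    and "continuous_on UNIV \<Phi>"
    and "(\<lambda>k. SUP C\<in>Mk k. ereal \<bar>\<Phi> C - \<Phi>k k C\<bar>) \<longlonglongrightarrow> 0"
    and "\<And>k. argmin_set (\<Phi>k k) (Mk k) \<noteq> {}"
  shows "argmin_set \<Phi> M \<noteq> {} \<and>
    (\<lambda>k. family_excess (argmin_set (\<Phi>k k) (Mk k)) (argmin_set \<Phi> M)) \<longlonglongrightarrow> 0"
proof
  note M = assms(1,2) and Mk = assms(3,4) and cont = assms(6)
  let ?S = "argmin_set \<Phi> M" and ?Sk = "\<lambda>k. argmin_set (\<Phi>k k) (Mk k)"
  show S: "?S \<noteq> {}"
    using M cont by (intro argmin_set_nonempty) (auto intro: continuous_on_subset)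
  have to_Mk: "(\<lambda>k. family_excess M (Mk k)) \<longlonglongrightarrow> 0"
    by (rule tendsto_sandwich[OF _ _ tendsto_const assms(5)])
      (auto simp: family_hausdorff_dist_def family_excess_nonneg M Mk)
  have to_M: "(\<lambda>k. family_excess (Mk k) M) \<longlonglongrightarrow> 0"
    by (rule tendsto_sandwich[OF _ _ tendsto_const assms(5)])
      (auto simp: family_hausdorff_dist_def family_excess_nonneg M Mk)
  have competitor: "\<exists>b'. (\<forall>k. b' k \<in> Mk k) \<and> b' \<longlonglongrightarrow> b" if b: "b \<in> M" for b
  proof -
    obtain b' where b': "\<And>k. b' k \<in> Mk k" "(\<lambda>k. dist b (b' k)) \<longlonglongrightarrow> 0"
      using nearest_bodies[where A = "\<lambda>_. b", OF to_Mk b Mk] by blast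
    then have "b' \<longlonglongrightarrow> b"
      by (simp add: tendsto_dist_iff[of b'] dist_commute)
    with b'(1) show ?thesis by blast
  qed
  have error: "(\<lambda>k. \<Phi> (x k) - \<Phi>k k (x k)) \<longlonglongrightarrow> 0" if "\<And>k. x k \<in> Mk k" for x
  proof -
    have "(\<lambda>k. \<bar>\<Phi> (x k) - \<Phi>k k (x k)\<bar>) \<longlonglongrightarrow> 0"
      using assms(7) by (rule real_tendsto_0_of_ereal_bound) (auto intro: SUP_upper that)
    then show ?thesis by (simp add: tendsto_rabs_zero_iff)
  qed
  have selection: "(\<lambda>k. infdist (c k) ?S) \<longlonglongrightarrow> 0" if c: "\<And>k. c k \<in> ?Sk k" for c
  proof -
    have "c k \<in> Mk k" for k
      using c by (simp add: argmin_set_iff)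
    then obtain p where p: "\<And>k. p k \<in> M" "(\<lambda>k. dist (c k) (p k)) \<longlonglongrightarrow> 0"
      using nearest_bodies[where A = c and Q = "\<lambda>_. M", OF to_M _ M] by blast
    show ?thesis
      using cont M(2) competitor error c p by (rule infdist_minimizers_tendsto_0)
  qed
  show "(\<lambda>k. family_excess (?Sk k) ?S) \<longlonglongrightarrow> 0"
  proof (rule order_tendstoI)
    fix y :: ereal assume "y < 0"
    then show "\<forall>\<^sub>F k in sequentially. y < family_excess (?Sk k) ?S"
      using assms(8) by (auto intro!: always_eventually less_le_trans[OF _ family_excess_nonneg])
  next
    fix y :: ereal assume "0 < y"
    then obtain e where e: "0 < e" "ereal e < y"
      using ereal_dense2[of 0 y] by (auto simp: zero_ereal_def)
    \<comment> \<open>Selecting an \<open>e\<close>-distant minimizer wherever there is one makes the bound on this single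
      selection a bound on all minimizers.\<close>
    have "\<exists>C. C \<in> ?Sk k \<and> ((\<exists>A\<in>?Sk k. e \<le> infdist A ?S) \<longrightarrow> e \<le> infdist C ?S)" for k
      using assms(8)[of k] by blast
    then obtain c where c: "\<And>k. c k \<in> ?Sk k"
      "\<And>k A. A \<in> ?Sk k \<Longrightarrow> e \<le> infdist A ?S \<Longrightarrow> e \<le> infdist (c k) ?S"
      by metis
    have "\<forall>\<^sub>F k in sequentially. infdist (c k) ?S < e"
      using selection[OF c(1)] e(1) by (rule order_tendstoD)
    then show "\<forall>\<^sub>F k in sequentially. family_excess (?Sk k) ?S < y"
    proof eventually_elim
      case (elim k)
      then have "infdist A ?S < e" if "A \<in> ?Sk k" for A
        using c(2)[OF that] by (meson not_le)
      then show ?case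
        using le_less_trans[OF family_excess_le[OF S] e(2)] by blast
    qed
  qed
qed

end
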